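(* Let $p$ be an odd prime and $q$ a power of $p$. (i) $\mathbb{F}_{q^2}\setminus\mathbb{F}_q$ is exactly the set of roots of $(x-x^q)^{q-1}+1$. (ii) Let $i$ be an integer with $0<i\le\frac12(p-1)$ and $n=q^{p+2i}-q^p-1$. Then for $x\in\mathbb{F}_{q^2}$, $g_{n,q}(x)=(2i-1)x^{q-2}$ if $x\in\mathbb{F}_q$, and $g_{n,q}(x)=\frac{2i-1}{x}+\frac{2i}{x^q}$ if $x\in\mathbb{F}_{q^2}\setminus\mathbb{F}_q$. (iii) For $n$ as in (ii), $g_{n,q}$ is a permutation polynomial of $\mathbb{F}_{q^2}$ if and only if $4i\not\equiv 1\pmod p$.
   Context: For a prime $p$, a power $q$ of $p$ and an integer $n\ge 0$, $g_{n,q}\in\mathbb{F}_p[x]$ is the unique polynomial with $\sum_{a\in\mathbb{F}_q}(x+a)^n=g_{n,q}(x^q-x)$. A permutation polynomial of a finite field $\mathbb{F}$ is a polynomial inducing a bijection of $\mathbb{F}$. *)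

theory Defs
  imports "HOL-Computational_Algebra.Computational_Algebra" "HOL-Number_Theory.Cong"
begin

(* All finite fields live inside one ambient field, given by the type 'a. Each finite field is
   the set of its elements; taking an algebraically closed field for 'a, the "set of
   roots" of a polynomial is its set of roots in an algebraic closure. *)

definition is_subfield :: "'a::field set \<Rightarrow> bool" where
  "is_subfield F \<longleftrightarrow> 0 \<in> F \<and> 1 \<in> F \<and>
     (\<forall>x\<in>F. \<forall>y\<in>F. x - y \<in> F \<and> x * y \<in> F) \<and> (\<forall>x\<in>F. inverse x \<in> F)"

(* For a subfield F with q elements, the polynomial with sum of (x+a)^n over a in F equal to
   g(x^q - x). The set of all of_int m is the prime field, so the first conjunct says that g has
   coefficients in F_p. *)
definition is_g_poly :: "nat \<Rightarrow> 'a::field set \<Rightarrow> 'a poly \<Rightarrow> bool" where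
  "is_g_poly n F g \<longleftrightarrow>
     (\<forall>k. coeff g k \<in> range of_int) \<and>
     (\<Sum>a\<in>F. ([:0, 1:] + [:a:]) ^ n) = pcompose g ([:0, 1:] ^ card F - [:0, 1:])"

definition g_poly :: "nat \<Rightarrow> 'a::field set \<Rightarrow> 'a poly" where
  "g_poly n F = (THE g. is_g_poly n F g)"

definition permutation_poly_on :: "'a::field set \<Rightarrow> 'a poly \<Rightarrow> bool" where
  "permutation_poly_on K f \<longleftrightarrow> bij_betw (poly f) K K"


subsection \<open>The polynomial g is well defined\<close>

lemma is_subfieldD:
  assumes "is_subfield F"
  shows "0 \<in> F" "1 \<in> F" "\<And>x y. x \<in> F \<Longrightarrow> y \<in> F \<Longrightarrow> x - y \<in> F"
    "\<And>x y. x \<in> F \<Longrightarrow> y \<in> F \<Longrightarrow> x * y \<in> F" "\<And>x. x \<in> F \<Longrightarrow> inverse x \<in> F"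
    "\<And>x y. x \<in> F \<Longrightarrow> y \<in> F \<Longrightarrow> x + y \<in> F"
proof -
  have *: "0 - y \<in> F" if "y \<in> F" for y using assms that unfolding is_subfield_def by blast
  show "x + y \<in> F" if "x \<in> F" "y \<in> F" for x y
  proof -
    have "x - (0 - y) \<in> F" using assms that * unfolding is_subfield_def by blast
    then show ?thesis by simp
  qed
qed (use assms in \<open>unfold is_subfield_def, blast+\<close>)

lemma is_subfield_card_gt_1:
  assumes "is_subfield F" "finite F"
  shows "card F > 1"
proof -
  have "card {0, 1 :: 'a} \<le> card F"
    using assms is_subfieldD(1,2)[OF assms(1)] by (intro card_mono) auto
  then show ?thesis by simp
qed

lemma bij_betw_mult_subfield:
  assumes F: "is_subfield F" and b: "b \<in> F" "b \<noteq> 0"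
  shows "bij_betw ((*) b) F F"
  by (rule bij_betwI[where g = "(*) (inverse b)"])
     (use assms is_subfieldD[OF F] in \<open>auto simp flip: mult.assoc\<close>)

lemma bij_betw_add_subfield:
  assumes F: "is_subfield F" and b: "b \<in> F"
  shows "bij_betw ((+) b) F F"
  by (rule bij_betwI[where g = "\<lambda>x. x - b"]) (use assms is_subfieldD[OF F] in auto)

lemma subfield_power_card_minus_1:
  assumes F: "is_subfield F" "finite F" and b: "b \<in> F" "b \<noteq> 0"
  shows "b ^ (card F - 1) = 1"
proof -
  let ?G = "F - {0}"
  have "bij_betw ((*) b) ?G ?G"
    by (rule bij_betwI[where g = "(*) (inverse b)"])
       (use assms is_subfieldD[OF F(1)] in \<open>auto simp flip: mult.assoc\<close>)
  then have "(\<Prod>x\<in>?G. b * x) = (\<Prod>x\<in>?G. x)"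
    by (rule prod.reindex_bij_betw)
  then have "b ^ card ?G * (\<Prod>x\<in>?G. x) = 1 * (\<Prod>x\<in>?G. x)"
    by (simp add: prod.distrib)
  moreover have "(\<Prod>x\<in>?G. x) \<noteq> 0" using F by simp
  ultimately have "b ^ card ?G = 1" by (metis mult_right_cancel)
  then show ?thesis using is_subfieldD(1)[OF F(1)] F(2) by simp
qed

lemma subfield_power_card:
  assumes F: "is_subfield F" "finite F" and b: "b \<in> F"
  shows "b ^ card F = b"
proof (cases "b = 0")
  case False
  have "b ^ card F = b ^ (card F - 1) * b"
    using is_subfield_card_gt_1[OF F] by (simp flip: power_Suc2)
  then show ?thesis using subfield_power_card_minus_1[OF F b False] by simp
next
  case True
  then show ?thesis using is_subfield_card_gt_1[OF F] by simp
qed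

lemma subfield_of_nat_card:
  fixes F :: "'a::field set"
  assumes F: "is_subfield F" "finite F"
  shows "(of_nat (card F) :: 'a) = 0"
proof -
  have "(\<Sum>x\<in>F. 1 + x) = (\<Sum>x\<in>F. x)"
    using bij_betw_add_subfield[OF F(1) is_subfieldD(2)[OF F(1)]] by (rule sum.reindex_bij_betw)
  then show ?thesis by (simp add: sum.distrib)
qed

lemma subfield_power_sum:
  assumes F: "is_subfield F" "finite F" and n: "n < card F"
  shows "(\<Sum>a\<in>F. a ^ n) \<in> range (of_int :: int \<Rightarrow> 'a::field)"
proof -
  have gt: "card F > 1" by (rule is_subfield_card_gt_1[OF F])
  have F0: "F = insert 0 (F - {0})" using is_subfieldD(1)[OF F(1)] by auto
  consider "n = 0" | "n = card F - 1" | "0 < n" "n < card F - 1" using n by linarith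
  then show ?thesis
  proof cases
    case 1
    then have "(\<Sum>a\<in>F. a ^ n) = of_int (int (card F))" by simp
    then show ?thesis by blast
  next
    case 2
    have "(\<Sum>a\<in>F - {0}. a ^ n) = (\<Sum>a\<in>F - {0}. 1)"
      using 2 subfield_power_card_minus_1[OF F] by (intro sum.cong) auto
    moreover have "(\<Sum>a\<in>F. a ^ n) = (\<Sum>a\<in>F - {0}. a ^ n)"
      using 2 gt F by (intro sum.mono_neutral_right) auto
    ultimately have "(\<Sum>a\<in>F. a ^ n) = of_int (int (card (F - {0})))" by simp
    then show ?thesis by blast
  next
    case 3
    have "\<exists>b\<in>F. b \<noteq> 0 \<and> b ^ n \<noteq> 1"
    proof (rule ccontr)
      assume A: "\<not> ?thesis"
      let ?P = "monom 1 n - 1 :: 'a poly"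
      have "coeff ?P n = 1" using 3 by simp
      then have nz: "?P \<noteq> 0" by (metis coeff_0 zero_neq_one)
      have "card (F - {0}) \<le> card {x. poly ?P x = 0}"
        using A by (intro card_mono poly_roots_finite nz) (auto simp: poly_monom)
      also have "\<dots> \<le> degree ?P" by (rule card_poly_roots_bound[OF nz])
      also have "\<dots> \<le> n" by (intro degree_diff_le degree_monom_le) auto
      finally show False using 3 F is_subfieldD(1)[OF F(1)] by simp
    qed
    then obtain b where b: "b \<in> F" "b \<noteq> 0" "b ^ n \<noteq> 1" by blast
    have "(\<Sum>a\<in>F. (b * a) ^ n) = (\<Sum>a\<in>F. a ^ n)"
      using bij_betw_mult_subfield[OF F(1) b(1,2)] by (rule sum.reindex_bij_betw)
    then have "b ^ n * (\<Sum>a\<in>F. a ^ n) = 1 * (\<Sum>a\<in>F. a ^ n)"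
      by (simp add: power_mult_distrib sum_distrib_left)
    then have "(\<Sum>a\<in>F. a ^ n) = of_int 0" using b(3) by (metis mult_right_cancel of_int_0)
    then show ?thesis by blast
  qed
qed

lemma degree_artin_schreier:
  assumes "q > 1"
  shows "degree ([:0, 1:] ^ q - [:0, 1:] :: 'a::field poly) > 0"
proof -
  have "([:0, 1:] ^ q - [:0, 1:] :: 'a poly) = monom 1 q - monom 1 1"
    by (simp add: monom_altdef)
  then have "coeff ([:0, 1:] ^ q - [:0, 1:] :: 'a poly) q = 1"
    using assms by simp
  then have "q \<le> degree ([:0, 1:] ^ q - [:0, 1:] :: 'a poly)"
    by (intro le_degree) simp
  then show ?thesis using assms by simp
qed

lemma artin_schreier_shift:
  fixes F :: "'a::field set"
  assumes F: "is_subfield F" "finite F" and p: "prime p" "card F = p ^ k" and a: "a \<in> F"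
  shows "([:0, 1:] + [:a:]) ^ card F = [:0, 1:] ^ card F + [:a:]"
proof -
  have k: "k > 0" using is_subfield_card_gt_1[OF F] p by (cases k) auto
  have "(of_nat p :: 'a) ^ k = 0" using subfield_of_nat_card[OF F] p by simp
  then have "(of_nat p :: 'a) = 0" by simp
  then have "CHAR('a) dvd p" by (simp add: of_nat_eq_0_iff_char_dvd)
  moreover have "CHAR('a) \<noteq> 1" by simp
  ultimately have p': "p = CHAR('a)" using p(1) by (metis prime_nat_iff)
  have "([:0, 1:] + [:a:]) ^ card F = [:0, 1:] ^ card F + [:a:] ^ card F"
    unfolding p(2) by (rule freshmans_dream') (use p p' in auto)
  also have "[:a:] ^ card F = [:a:]"
    using subfield_power_card[OF F a] by (simp add: poly_const_pow)
  finally show ?thesis .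
qed

lemma is_g_poly_exists:
  fixes F :: "'a::field set"
  assumes F: "is_subfield F" "finite F" and p: "prime p" "card F = p ^ k"
  shows "\<exists>g. is_g_poly n F g"
proof (induction n rule: less_induct)
  case (less n)
  define q where "q = card F"
  define T :: "'a poly" where "T = [:0, 1:] ^ q - [:0, 1:]"
  define S where "S m = (\<Sum>a\<in>F. ([:0, 1:] + [:a:]) ^ m)" for m
  have q: "q > 1" using is_subfield_card_gt_1[OF F] by (simp add: q_def)
  show ?case
  proof (cases "n < q")
    case True
    let ?c = "\<Sum>a\<in>F. a ^ n"
    obtain c where c: "?c = of_int c" using subfield_power_sum[OF F, of n] True
      by (auto simp: q_def)
    have deg_lin: "degree (([:0, 1:] + [:a:]) ^ n) = n" for a :: 'a
      by (simp add: degree_power_eq)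
    have deg: "degree (S n - [:?c:]) < card F"
    proof -
      have "degree (S n - [:?c:]) \<le> n"
        unfolding S_def using deg_lin F by (intro degree_diff_le degree_sum_le) auto
      then show ?thesis using True by (simp add: q_def)
    qed
    have root: "poly (S n) b = ?c" if b: "b \<in> F" for b
    proof -
      have "poly (S n) b = (\<Sum>a\<in>F. (b + a) ^ n)" by (simp add: S_def poly_sum add.commute)
      also have "\<dots> = ?c"
        using bij_betw_add_subfield[OF F(1) b] by (rule sum.reindex_bij_betw)
      finally show ?thesis .
    qed
    have "S n - [:?c:] = 0"
      by (rule poly_eqI_degree[where A = F]) (use deg root in auto)
    then have "S n = [:?c:]" by simp
    then have "is_g_poly n F [:?c:]"
      unfolding is_g_poly_def c S_def using rangeI[of of_int c] rangeI[of of_int 0]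
      by (auto simp: coeff_pCons split: nat.splits)
    then show ?thesis ..
  next
    case False
    have lt: "n - q + 1 < n" "n - q < n" using q False by linarith+
    obtain g where g: "is_g_poly (n - q + 1) F g" using less[OF lt(1)] ..
    obtain h where h: "is_g_poly (n - q) F h" using less[OF lt(2)] ..
    have "([:0, 1:] + [:a:]) ^ n =
        ([:0, 1:] + [:a:]) ^ (n - q + 1) + T * ([:0, 1:] + [:a:]) ^ (n - q)"
      if a: "a \<in> F" for a
    proof -
      have "([:0, 1:] + [:a:]) ^ n = ([:0, 1:] + [:a:]) ^ q * ([:0, 1:] + [:a:]) ^ (n - q)"
        using False by (simp flip: power_add)
      also have "([:0, 1:] + [:a:]) ^ q = T + ([:0, 1:] + [:a:])"
        using artin_schreier_shift[OF F p a] by (simp add: T_def q_def)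
      also have "(T + ([:0, 1:] + [:a:])) * ([:0, 1:] + [:a:]) ^ (n - q) =
        ([:0, 1:] + [:a:]) ^ (n - q + 1) + T * ([:0, 1:] + [:a:]) ^ (n - q)"
        unfolding power_add power_one_right distrib_right[of T]
        by (simp only: add.commute mult.commute)
      finally show ?thesis .
    qed
    then have "S n = S (n - q + 1) + T * S (n - q)"
      unfolding S_def sum_distrib_left sum.distrib[symmetric] by (rule sum.cong[OF refl])
    also have "\<dots> = pcompose g T + T * pcompose h T"
      using g h unfolding is_g_poly_def S_def T_def q_def by simp
    also have "\<dots> = pcompose (g + pCons 0 h) T"
      by (simp add: pcompose_add pcompose_pCons)
    finally have eq: "S n = pcompose (g + pCons 0 h) T" .
    have "coeff (g + pCons 0 h) i \<in> range of_int" for i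
    proof -
      obtain u where u: "coeff g i = of_int u" using g unfolding is_g_poly_def by blast
      have "\<exists>v. coeff (pCons 0 h) i = of_int v"
      proof (cases i)
        case 0
        then show ?thesis by (intro exI[of _ 0]) simp
      next
        case (Suc j)
        then show ?thesis using h unfolding is_g_poly_def by (auto simp: image_iff)
      qed
      then obtain v where v: "coeff (pCons 0 h) i = of_int v" ..
      have "coeff (g + pCons 0 h) i = of_int (u + v)" using u v by simp
      then show ?thesis by blast
    qed
    then have "is_g_poly n F (g + pCons 0 h)"
      using eq unfolding is_g_poly_def S_def T_def q_def by blast
    then show ?thesis ..
  qed
qed

lemma is_g_poly_unique:
  fixes F :: "'a::field set"
  assumes F: "is_subfield F" "finite F" and "is_g_poly n F g" "is_g_poly n F h"
  shows "g = h"
proof -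
  let ?T = "[:0, 1:] ^ card F - [:0, 1:] :: 'a poly"
  have "pcompose (g - h) ?T = 0"
    using assms(3,4) unfolding is_g_poly_def by (simp add: pcompose_diff)
  then have "g - h = 0"
    by (rule pcompose_eq_0) (rule degree_artin_schreier[OF is_subfield_card_gt_1[OF F]])
  then show ?thesis by simp
qed

theorem is_g_poly_g_poly:
  assumes F: "is_subfield F" "finite F" and p: "prime p" "card F = p ^ k"
  shows "is_g_poly n F (g_poly n F)"
proof -
  have "\<exists>!g. is_g_poly n F g"
    using is_g_poly_exists[OF F p] is_g_poly_unique[OF F] by blast
  then show ?thesis unfolding g_poly_def by (rule theI')
qed

end

theory Submission
  imports Defs "HOL-Algebra.Algebraic_Closure_Type"
begin

hide_const (open) Divisibility.prime Polynomials.lead_coeff Polynomials.degree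
  UnivPoly.coeff UnivPoly.monom

text \<open>
  Given \<open>x\<close> with \<open>x ^ q\<^sup>2 = x\<close>, choose \<open>y\<close> in the algebraic closure with \<open>y ^ q = y + x\<close>; then
  \<open>g x = (\<Sum>a\<in>F. (y + a) ^ n)\<close>, a sum over all solutions \<open>z = y + a\<close> of \<open>z ^ q = z + x\<close>. Iterating
  Frobenius on such a \<open>z\<close> gives, with \<open>t = x + x ^ q\<close> and \<open>h = (x - x ^ q) / 2\<close> (as \<open>(p - 1) / 2\<close> is
  \<open>- 1 / 2\<close> in characteristic \<open>p\<close>), \<open>z ^ q ^ p = z + h\<close> and \<open>z ^ q ^ (p + 2 i) = z + h + i t\<close>, so
  \<open>z ^ n = (z + h + i t) / (z (z + h))\<close>. Partial fractions reduce the sum to reciprocals of \<open>z\<close>,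
  \<open>z\<^sup>2\<close> and \<open>z + h\<close>, and \<open>(z + h) ^ q = z + h + x ^ q\<close>. The substitution \<open>w = 1 / x\<close> then turns \<open>g\<close>
  into a piecewise linear map over \<open>F\<close>.
\<close>

section \<open>Finite subfields as root sets, and reciprocal sums over their translates\<close>

text \<open>The elements of \<open>F\<close> are already \<open>card F\<close> roots of X^q - X, and
  its degree leaves room for no others.\<close>

lemma power_card_eq_iff_mem_subfield:
  fixes F :: "'a::field set"
  assumes F: "is_subfield F" "finite F"
  shows "x ^ card F = x \<longleftrightarrow> x \<in> F"
proof
  assume x: "x ^ card F = x"
  let ?P = "[:0, 1:] ^ card F - [:0, 1:] :: 'a poly"
  have nz: "?P \<noteq> 0"
    using degree_artin_schreier[OF is_subfield_card_gt_1[OF F], where 'a = 'a] by auto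
  have "card {x. poly ?P x = 0} \<le> degree ?P" by (rule card_poly_roots_bound[OF nz])
  also have "\<dots> \<le> card F"
    using is_subfield_card_gt_1[OF F]
    by (intro degree_diff_le) (auto intro!: order.trans[OF degree_power_le])
  finally have "card {x. poly ?P x = 0} \<le> card F" .
  moreover have "F \<subseteq> {x. poly ?P x = 0}" using subfield_power_card[OF F] by auto
  ultimately have "F = {x. poly ?P x = 0}" using poly_roots_finite[OF nz] by (intro card_seteq)
  then show "x \<in> F" using x by auto
qed (rule subfield_power_card[OF F])

text \<open>Both sides are monic of degree \<open>card F\<close> and agree at the
  \<open>card F\<close> points of \<open>F\<close>.\<close>

lemma prod_subfield_linear_factors:
  fixes F :: "'a::field set"
  assumes F: "is_subfield F" "finite F"
  shows "(\<Prod>a\<in>F. [:- a, 1:]) = [:0, 1:] ^ card F - [:0, 1:]"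
proof (rule poly_eqI_degree_lead_coeff[where A = F and n = "card F"])
  let ?X = "[:0, 1:] :: 'a poly"
  have q: "card F > 1" by (rule is_subfield_card_gt_1[OF F])
  have deg: "degree (\<Prod>a\<in>F. [:- a, 1:]) = card F"
    by (subst degree_prod_sum_eq) auto
  show "degree (\<Prod>a\<in>F. [:- a, 1:]) \<le> card F" using deg by simp
  show "degree (?X ^ card F - ?X) \<le> card F"
    using q by (intro degree_diff_le) (auto intro!: order.trans[OF degree_power_le])
  have "lead_coeff (\<Prod>a\<in>F. [:- a, 1:]) = 1" by (simp add: lead_coeff_prod)
  moreover have "?X ^ card F - ?X = monom 1 (card F) - monom 1 1" by (simp add: monom_altdef)
  ultimately show "coeff (\<Prod>a\<in>F. [:- a, 1:]) (card F)
      = coeff (?X ^ card F - ?X) (card F)"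
    using q deg by simp
  show "poly (\<Prod>a\<in>F. [:- a, 1:]) z = poly (?X ^ card F - ?X) z" if "z \<in> F" for z
    using that subfield_power_card[OF F that] F by (auto simp: poly_prod)
qed simp

text \<open>Logarithmic derivative of \<open>X ^ q - X\<close>, whose derivative is the constant \<open>-1\<close>.\<close>
lemma sum_inverse_subfield_translates:
  fixes F :: "'a::field set"
  assumes F: "is_subfield F" "finite F" and y: "y \<notin> F"
  shows "(\<Sum>a\<in>F. inverse (y + a)) = - inverse (y ^ card F - y)"
proof -
  let ?P = "\<Prod>a\<in>F. [:- a, 1:]"
  have nz: "y - a \<noteq> 0" if "a \<in> F" for a using that y by auto
  have P: "poly ?P y = (\<Prod>a\<in>F. y - a)" by (simp add: poly_prod)
  have Py: "poly ?P y = y ^ card F - y" by (simp add: prod_subfield_linear_factors[OF F])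
  have "pderiv ?P = - 1"
    by (simp add: prod_subfield_linear_factors[OF F] pderiv_diff pderiv_power
        subfield_of_nat_card[OF F] pderiv_pCons one_pCons)
  then have "-1 = poly (pderiv ?P) y" by simp
  also have "\<dots> = (\<Sum>a\<in>F. \<Prod>b\<in>F - {a}. y - b)"
    by (simp add: pderiv_prod poly_sum poly_prod pderiv_pCons)
  also have "\<dots> = (\<Sum>a\<in>F. poly ?P y * inverse (y - a))"
  proof (rule sum.cong[OF refl])
    fix a assume a: "a \<in> F"
    show "(\<Prod>b\<in>F - {a}. y - b) = poly ?P y * inverse (y - a)"
      unfolding P using nz[OF a] by (subst prod.remove[OF F(2) a]) simp
  qed
  also have "\<dots> = (y ^ card F - y) * (\<Sum>a\<in>F. inverse (y - a))"
    by (simp add: Py sum_distrib_left)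
  also have "(\<Sum>a\<in>F. inverse (y - a)) = (\<Sum>a\<in>F. inverse (y + a))"
    by (rule sum.reindex_bij_witness[of _ uminus uminus])
      (use is_subfieldD(3)[OF F(1) is_subfieldD(1)[OF F(1)]] in auto)
  finally have "(y ^ card F - y) * (\<Sum>a\<in>F. inverse (y + a)) = - 1" by simp
  moreover have "y ^ card F - y \<noteq> 0"
    using y power_card_eq_iff_mem_subfield[OF F] by auto
  ultimately show ?thesis by (simp add: field_simps)
qed

text \<open>The square of \<open>\<Sum>a\<in>F. 1 / (y + a)\<close> has no off-diagonal contribution: for fixed \<open>d \<noteq> 0\<close>,
  \<open>1 / ((y + a) (y + a + d)) = (1 / (y + a) - 1 / (y + a + d)) / d\<close> sums to \<open>0\<close> over \<open>a\<close>.\<close>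
lemma sum_inverse_square_subfield_translates:
  fixes F :: "'a::field set"
  assumes F: "is_subfield F" "finite F" and y: "y \<notin> F"
  shows "(\<Sum>a\<in>F. inverse (y + a) ^ 2) = inverse (y ^ card F - y) ^ 2"
proof -
  let ?r = "\<lambda>a. inverse (y + a)"
  have nz: "y + a \<noteq> 0" if "a \<in> F" for a
  proof
    assume "y + a = 0"
    then have "y = 0 - a" by (simp add: eq_neg_iff_add_eq_0)
    then show False using y is_subfieldD(3)[OF F(1) is_subfieldD(1)[OF F(1)] that] by simp
  qed
  have shift: "(\<Sum>a\<in>F. ?r (d + a)) = (\<Sum>a\<in>F. ?r a)" if "d \<in> F" for d
    using bij_betw_add_subfield[OF F(1) that] by (rule sum.reindex_bij_betw)
  have off: "(\<Sum>a\<in>F. ?r a * ?r (d + a)) = 0" if d: "d \<in> F" "d \<noteq> 0" for d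
  proof -
    have "(\<Sum>a\<in>F. ?r a * ?r (d + a)) = (\<Sum>a\<in>F. inverse d * (?r a - ?r (d + a)))"
    proof (rule sum.cong[OF refl])
      fix a assume "a \<in> F"
      then have "y + a \<noteq> 0" "y + (d + a) \<noteq> 0" using nz is_subfieldD(6)[OF F(1) d(1)] by auto
      then show "?r a * ?r (d + a) = inverse d * (?r a - ?r (d + a))"
        using d by (simp add: field_simps)
    qed
    also have "\<dots> = inverse d * ((\<Sum>a\<in>F. ?r a) - (\<Sum>a\<in>F. ?r (d + a)))"
      by (simp flip: sum_distrib_left add: sum_subtractf)
    finally show ?thesis using shift[OF d(1)] by simp
  qed
  have "(\<Sum>a\<in>F. ?r a) ^ 2 = (\<Sum>a\<in>F. ?r a * (\<Sum>d\<in>F. ?r d))"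
    by (simp add: power2_eq_square sum_distrib_right)
  also have "\<dots> = (\<Sum>a\<in>F. ?r a * (\<Sum>d\<in>F. ?r (d + a)))"
    using shift by (intro sum.cong refl) (simp add: add.commute)
  also have "\<dots> = (\<Sum>a\<in>F. \<Sum>d\<in>F. ?r a * ?r (d + a))" by (simp add: sum_distrib_left)
  also have "\<dots> = (\<Sum>d\<in>F. \<Sum>a\<in>F. ?r a * ?r (d + a))" by (rule sum.swap)
  also have "\<dots> = (\<Sum>a\<in>F. ?r a * ?r (0 + a)) + (\<Sum>d\<in>F - {0}. \<Sum>a\<in>F. ?r a * ?r (d + a))"
    by (rule sum.remove[OF F(2) is_subfieldD(1)[OF F(1)]])
  also have "(\<Sum>d\<in>F - {0}. \<Sum>a\<in>F. ?r a * ?r (d + a)) = 0" using off by (intro sum.neutral) auto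
  finally have "(\<Sum>a\<in>F. ?r a ^ 2) = (\<Sum>a\<in>F. ?r a) ^ 2" by (simp add: power2_eq_square)
  then show ?thesis by (simp add: sum_inverse_subfield_translates[OF F y])
qed

lemma subfield_of_nat_mem:
  assumes "is_subfield F"
  shows "of_nat j \<in> F"
  by (induction j) (use is_subfieldD[OF assms] in auto)

text \<open>The term at 0 is harmless since \<open>inverse 0 = 0\<close>. Multiplying the summation
  variable by some \<open>b\<close> other than 0 and 1 scales the sum by \<open>inverse b\<close>
  but only permutes its terms; \<open>card F > 2\<close> supplies such a \<open>b\<close>.\<close>

lemma sum_subfield_inverse_eq_0:
  fixes F :: "'a::field set"
  assumes F: "is_subfield F" "finite F" and q: "card F > 2"
  shows "(\<Sum>a\<in>F. inverse a) = 0"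
proof -
  have "\<not> F \<subseteq> {0, 1}"
  proof
    assume "F \<subseteq> {0, 1}"
    then have "card F \<le> card {0, 1 :: 'a}" by (intro card_mono) auto
    then show False using q by simp
  qed
  then obtain b where b: "b \<in> F" "b \<noteq> 0" "b \<noteq> 1" by blast
  have "(\<Sum>a\<in>F. inverse (b * a)) = (\<Sum>a\<in>F. inverse a)"
    using bij_betw_mult_subfield[OF F(1) b(1,2)] by (rule sum.reindex_bij_betw)
  then have "inverse b * (\<Sum>a\<in>F. inverse a) = (\<Sum>a\<in>F. inverse a)"
    by (simp add: sum_distrib_left mult.commute)
  then have "(\<Sum>a\<in>F. inverse a) = b * (\<Sum>a\<in>F. inverse a)"
    using b(2) by (simp add: field_simps)
  then have "(b - 1) * (\<Sum>a\<in>F. inverse a) = 0" by (simp add: algebra_simps)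
  then show ?thesis using b(3) by simp
qed

section \<open>Frobenius iterates of Artin-Schreier roots and the resulting power sum\<close>

locale prime_power_subfield =
  fixes F :: "'a::field set" and p m q :: nat
  assumes prime_p: "prime p" and q_eq: "q = p ^ m"
    and subfield: "is_subfield F" and card_F: "card F = q"
begin

lemma finite_F: "finite F"
  using card_F q_eq prime_p by (intro card_ge_0_finite) (simp add: prime_gt_0_nat)

lemma q_gt_1: "q > 1"
  using is_subfield_card_gt_1[OF subfield finite_F] card_F by simp

lemma power_q_eq_iff: "x ^ q = x \<longleftrightarrow> x \<in> F"
  using power_card_eq_iff_mem_subfield[OF subfield finite_F] card_F by simp

lemma CHAR_eq: "CHAR('a) = p"
proof -
  have "(of_nat p :: 'a) ^ m = 0"
    using subfield_of_nat_card[OF subfield finite_F] by (simp add: card_F q_eq)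
  then have "CHAR('a) dvd p" by (simp add: of_nat_eq_0_iff_char_dvd)
  moreover have "CHAR('a) \<noteq> 1" by simp
  ultimately show ?thesis using prime_p by (metis prime_nat_iff)
qed

lemma of_nat_p: "(of_nat p :: 'a) = 0"
  by (simp add: of_nat_eq_0_iff_char_dvd CHAR_eq)

lemma frobenius_add: "(x + y :: 'a) ^ q = x ^ q + y ^ q"
  unfolding q_eq by (rule freshmans_dream') (use prime_p CHAR_eq in auto)

lemma frobenius_minus: "(- x :: 'a) ^ q = - (x ^ q)"
  using frobenius_add[of "- x" x] q_gt_1 by (simp add: eq_neg_iff_add_eq_0 power_0_left)

lemma frobenius_diff: "(x - y :: 'a) ^ q = x ^ q - y ^ q"
  using frobenius_add[of x "- y"] by (simp add: frobenius_minus)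

lemma frobenius_of_nat: "(of_nat j :: 'a) ^ q = of_nat j"
  using subfield_of_nat_mem[OF subfield] power_q_eq_iff by blast

text \<open>Two applications of Frobenius add the trace \<open>x + x ^ q\<close> to
  \<open>z\<close>. The trace is itself fixed by Frobenius, so the increments accumulate
  linearly.\<close>

lemma artin_schreier_even_iterate:
  fixes x z :: 'a
  assumes z: "z ^ q = z + x" and x: "(x ^ q) ^ q = x"
  shows "z ^ (q ^ (2 * j)) = z + of_nat j * (x + x ^ q)"
proof (induction j)
  case (Suc j)
  have "z ^ (q ^ (2 * Suc j)) = ((z ^ (q ^ (2 * j))) ^ q) ^ q"
    by (simp add: power_mult[symmetric] mult_ac)
  also have "\<dots> = z + of_nat (Suc j) * (x + x ^ q)"
    unfolding Suc by (simp add: frobenius_add power_mult_distrib frobenius_of_nat z x algebra_simps)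
  finally show ?case .
qed simp

lemma artin_schreier_odd_iterate:
  fixes x z :: 'a
  assumes z: "z ^ q = z + x" and x: "(x ^ q) ^ q = x"
  shows "z ^ (q ^ (2 * j + 1)) = z + x + of_nat j * (x + x ^ q)"
proof -
  have "z ^ (q ^ (2 * j + 1)) = (z ^ (q ^ (2 * j))) ^ q"
    by (simp add: power_mult[symmetric] mult.commute)
  also have "\<dots> = z + x + of_nat j * (x + x ^ q)"
    unfolding artin_schreier_even_iterate[OF assms] by (simp add: frobenius_add power_mult_distrib
        frobenius_of_nat z x algebra_simps)
  finally show ?thesis .
qed

text \<open>The exponent is given additively, so that powers of \<open>z\<close> can be multiplied
  without truncated subtraction. With \<open>inverse 0 = 0\<close> the first branch also covers
  \<open>x = 0\<close>.\<close>

lemma power_sum_translates: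
  fixes x y :: 'a
  assumes p: "odd p" and y: "y ^ q = y + x" and x: "(x ^ q) ^ q = x"
    and n: "n + q ^ p + 1 = q ^ (p + 2 * i)" "n > 0"
  shows "(\<Sum>a\<in>F. (y + a) ^ n) =
    (if x \<in> F then (2 * of_nat i - 1) * inverse x
     else (2 * of_nat i - 1) * inverse x + 2 * of_nat i * inverse (x ^ q))"
proof -
  obtain k where k: "p = 2 * k + 1" using p by (auto elim: oddE)
  define t where "t = x + x ^ q"
  define h where "h = x + of_nat k * t"
  have k0: "2 * of_nat k + 1 = (0 :: 'a)" using of_nat_p by (simp add: k add.commute)
  have two: "(2 :: 'a) \<noteq> 0"
  proof
    assume "(2 :: 'a) = 0"
    then show False using k0 by simp
  qed
  have h2: "2 * h = x - x ^ q"
  proof -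
    have "2 * h = 2 * x + (2 * of_nat k + 1) * t - t" by (simp add: h_def algebra_simps)
    then show ?thesis using k0 by (simp add: t_def)
  qed
  have pow: "(y + a) ^ n = (y + a + h + of_nat i * t) * inverse (y + a) * inverse (y + a + h)"
    if a: "a \<in> F" for a
  proof -
    let ?z = "y + a"
    have z: "?z ^ q = ?z + x" using y a power_q_eq_iff by (simp add: frobenius_add)
    have zp: "?z ^ (q ^ p) = ?z + h"
      using artin_schreier_odd_iterate[OF z x, of k] by (simp add: k h_def t_def add.assoc)
    have "?z ^ (q ^ (p + 2 * i)) = ?z + h + of_nat i * t"
      using artin_schreier_odd_iterate[OF z x, of "k + i"] by (simp add: k h_def t_def algebra_simps)
    then have *: "?z ^ n * (?z + h) * ?z = ?z + h + of_nat i * t"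
      by (simp only: n(1)[symmetric] power_add[of ?z] power_one_right zp)
    \<comment> \<open>Dividing requires \<open>?z\<close> to be nonzero. At \<open>?z = 0\<close>
      both sides are 0, the left because \<open>n > 0\<close> and the right because
      \<open>inverse 0 = 0\<close>.\<close>
    show ?thesis
    proof (cases "?z = 0")
      case False
      \<comment> \<open>\<open>?z + h\<close> is a power of \<open>?z\<close>, hence nonzero along
        with it.\<close>
      moreover from this have "?z + h \<noteq> 0" using zp q_gt_1 by (metis power_eq_0_iff)
      ultimately have "?z ^ n = (?z + h + of_nat i * t) / ((?z + h) * ?z)"
        using * by (intro eq_divide_imp) (auto simp: mult.assoc)
      then show ?thesis by (simp add: divide_inverse mult_ac)
    qed (use n(2) in simp)
  qed
  have yF: "y \<in> F \<longleftrightarrow> x = 0" using power_q_eq_iff[of y] y by auto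
  have sum_inv: "(\<Sum>a\<in>F. inverse (y + a)) = - inverse x" if "x \<noteq> 0"
    using sum_inverse_subfield_translates[OF subfield finite_F, of y] that yF y card_F by simp
  show ?thesis
  proof (cases "x \<in> F")
    case True
    then have xq: "x ^ q = x" using power_q_eq_iff by simp
    then have h0: "h = 0" using h2 two by simp
    have t: "t = 2 * x" using xq by (simp add: t_def)
    \<comment> \<open>With \<open>h = 0\<close> the two poles coincide, which is where the sum of
      squared reciprocals enters.\<close>
    have *: "(y + a) ^ n = inverse (y + a) + 2 * of_nat i * x * inverse (y + a) ^ 2"
      if "a \<in> F" for a
    proof -
      have "(z + s) * inverse z * inverse z = inverse z + s * inverse z ^ 2" for z s :: 'a
        by (cases "z = 0") (simp_all add: field_simps power2_eq_square)
      from this[of "y + a" "of_nat i * t"] show ?thesis using pow[OF that] by (simp add: h0 t mult_ac)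
    qed
    have "(\<Sum>a\<in>F. (y + a) ^ n) =
        (\<Sum>a\<in>F. inverse (y + a)) + 2 * of_nat i * x * (\<Sum>a\<in>F. inverse (y + a) ^ 2)"
      using * by (simp add: sum.distrib sum_distrib_left)
    also have "\<dots> = (2 * of_nat i - 1) * inverse x"
    proof (cases "x = 0")
      case True
      \<comment> \<open>The translates now run through all of \<open>F\<close>, including 0, so the
        reciprocal sum for \<open>y\<close> outside \<open>F\<close> does not apply; the sum
        vanishes because the odd number \<open>q\<close> exceeds 2.\<close>
      then have "y \<in> F" using yF by simp
      have "(\<Sum>a\<in>F. inverse (y + a)) = (\<Sum>a\<in>F. inverse a)"
        using bij_betw_add_subfield[OF subfield \<open>y \<in> F\<close>] by (rule sum.reindex_bij_betw)
      also have "\<dots> = 0"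
      proof (rule sum_subfield_inverse_eq_0[OF subfield finite_F])
        have "odd q" using p by (simp add: q_eq)
        then show "card F > 2" using q_gt_1 card_F by (cases "q = 2") auto
      qed
      finally show ?thesis using True by simp
    next
      case False
      have "(\<Sum>a\<in>F. inverse (y + a) ^ 2) = inverse x ^ 2"
        using sum_inverse_square_subfield_translates[OF subfield finite_F, of y] yF False y card_F
        by simp
      then show ?thesis
        unfolding sum_inv[OF False] using False by (simp add: field_simps power2_eq_square)
    qed
    finally show ?thesis using True by simp
  next
    case False
    then have xq: "x ^ q \<noteq> x" using power_q_eq_iff by simp
    then have h0: "h \<noteq> 0" using h2 by auto
    have x0: "x \<noteq> 0" using False is_subfieldD(1)[OF subfield] by auto
    have hq: "h ^ q = h + x ^ q - x"
      by (simp add: h_def t_def frobenius_add power_mult_distrib frobenius_of_nat x algebra_simps)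
    have yh: "(y + h) ^ q = y + h + x ^ q" by (simp add: frobenius_add y hq)
    then have yhF: "y + h \<notin> F" using power_q_eq_iff[of "y + h"] x0 by auto
    have sum_inv': "(\<Sum>a\<in>F. inverse (y + a + h)) = - inverse (x ^ q)"
      using sum_inverse_subfield_translates[OF subfield finite_F yhF] yh card_F
      by (simp add: add_ac)
    have nz: "w + a \<noteq> 0" if "w \<notin> F" "a \<in> F" for w a
    proof
      assume "w + a = 0"
      then have "w = 0 - a" by (simp add: eq_neg_iff_add_eq_0)
      then show False using that is_subfieldD(3)[OF subfield is_subfieldD(1)[OF subfield]] by simp
    qed
    \<comment> \<open>Partial fractions with the distinct poles 0 and \<open>- h\<close>: (z + h +
      s) / (z (z + h)) = 1/z + (s/h) (1/z - 1/(z + h)).\<close>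
    have *: "(y + a) ^ n = inverse (y + a)
        + of_nat i * t * inverse h * (inverse (y + a) - inverse (y + a + h))"
      if a: "a \<in> F" for a
    proof -
      have "y + a \<noteq> 0" using nz[of y a] yF x0 a by simp
      moreover have "y + a + h \<noteq> 0" using nz[OF yhF a] by (simp add: add_ac)
      moreover have "(z + h + s) * inverse z * inverse (z + h)
          = inverse z + s * inverse h * (inverse z - inverse (z + h))"
        if "z \<noteq> 0" "z + h \<noteq> 0" for z s :: 'a
      proof -
        have "inverse h * (inverse z - inverse (z + h)) = inverse z * inverse (z + h)"
          using that h0 by (simp add: inverse_diff_inverse mult_ac)
        then have "inverse z + s * inverse h * (inverse z - inverse (z + h))
            = inverse z + s * (inverse z * inverse (z + h))"
          by (simp only: mult.assoc)
        moreover have "(z + h) * (inverse z * inverse (z + h)) = inverse z" using that(2) by simp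
        moreover have "(z + h + s) * inverse z * inverse (z + h)
            = (z + h) * (inverse z * inverse (z + h)) + s * (inverse z * inverse (z + h))"
          by (simp only: distrib_right mult.assoc add.assoc)
        ultimately show ?thesis by (simp only:)
      qed
      ultimately show ?thesis unfolding pow[OF a] by blast
    qed
    have "(\<Sum>a\<in>F. (y + a) ^ n) = (\<Sum>a\<in>F. inverse (y + a))
        + of_nat i * t * inverse h * ((\<Sum>a\<in>F. inverse (y + a)) - (\<Sum>a\<in>F. inverse (y + a + h)))"
      using * by (simp add: sum.distrib sum_subtractf flip: sum_distrib_left)
    also have "\<dots> = - inverse x + of_nat i * t * inverse h * (inverse (x ^ q) - inverse x)"
      using x0 by (simp add: sum_inv sum_inv')
    \<comment> \<open>This difference yields a factor \<open>2 * h\<close>, which cancels the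
      \<open>inverse h\<close> left by the partial fractions.\<close>
    also have "inverse (x ^ q) - inverse x = 2 * h * inverse x * inverse (x ^ q)"
      using x0 by (simp add: h2 divide_simps)
    also have "- inverse x + of_nat i * t * inverse h * (2 * h * inverse x * inverse (x ^ q))
        = - inverse x + 2 * of_nat i * (t * inverse x * inverse (x ^ q))"
      using h0 by simp
    also have "t * inverse x * inverse (x ^ q) = inverse x + inverse (x ^ q)"
      using x0 by (simp add: t_def field_simps)
    finally show ?thesis using False by (simp add: algebra_simps)
  qed
qed

end

section \<open>Base change to the algebraic closure and the values of \<open>g_poly\<close>\<close>

lemma map_poly_to_ac_add: "map_poly to_ac (f + g) = map_poly to_ac f + map_poly to_ac g"
  by (rule poly_eqI) (simp add: coeff_map_poly)

lemma map_poly_to_ac_mult: "map_poly to_ac (f * g) = map_poly to_ac f * map_poly to_ac g"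
  by (rule poly_eqI) (simp add: coeff_map_poly coeff_mult to_ac_sum)

lemma map_poly_to_ac_diff: "map_poly to_ac (f - g) = map_poly to_ac f - map_poly to_ac g"
  by (rule poly_eqI) (simp add: coeff_map_poly)

lemma map_poly_to_ac_power: "map_poly to_ac (f ^ n) = map_poly to_ac f ^ n"
  by (induction n) (simp_all add: map_poly_to_ac_mult)

lemma map_poly_to_ac_sum: "map_poly to_ac (\<Sum>a\<in>A. f a) = (\<Sum>a\<in>A. map_poly to_ac (f a))"
  by (rule poly_eqI) (simp add: coeff_map_poly coeff_sum to_ac_sum)

lemma map_poly_to_ac_pcompose:
  "map_poly to_ac (pcompose f g) = pcompose (map_poly to_ac f) (map_poly to_ac g)"
  by (induction f)
    (simp_all add: pcompose_pCons map_poly_pCons map_poly_to_ac_add map_poly_to_ac_mult)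

lemma poly_map_poly_to_ac: "poly (map_poly to_ac f) (to_ac x) = to_ac (poly f x)"
  by (induction f) (simp_all add: map_poly_pCons)

lemma is_subfield_to_ac_image:
  assumes "is_subfield F"
  shows "is_subfield (to_ac ` F)"
  unfolding is_subfield_def
proof (intro conjI ballI)
  show "0 \<in> to_ac ` F" "1 \<in> to_ac ` F"
    using is_subfieldD(1,2)[OF assms] by (metis imageI to_ac_0, metis imageI to_ac_1)
  show "u - v \<in> to_ac ` F" "u * v \<in> to_ac ` F" if "u \<in> to_ac ` F" "v \<in> to_ac ` F" for u v
    using that is_subfieldD(3,4)[OF assms]
    by (auto simp flip: to_ac_diff to_ac_mult)
  show "inverse u \<in> to_ac ` F" if "u \<in> to_ac ` F" for u
    using that is_subfieldD(5)[OF assms] by (auto simp flip: to_ac_inverse)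
qed

context prime_power_subfield
begin

text \<open>The defining identity of \<open>g_poly\<close> is evaluated at \<open>y\<close>. It is
  first transported along \<open>to_ac\<close>, since a \<open>y\<close> with
  \<open>y ^ q - y = x\<close> may exist only in the algebraic closure.\<close>

lemma poly_g_poly_via_root:
  assumes "y ^ q - y = to_ac x"
  shows "to_ac (poly (g_poly n F) x) = (\<Sum>a\<in>to_ac ` F. (y + a) ^ n)"
proof -
  let ?E = "\<lambda>f. poly (map_poly to_ac f) y"
  have "is_g_poly n F (g_poly n F)"
    by (rule is_g_poly_g_poly[OF subfield finite_F prime_p]) (simp add: card_F q_eq)
  then have "?E (\<Sum>a\<in>F. ([:0, 1:] + [:a:]) ^ n)
      = ?E (pcompose (g_poly n F) ([:0, 1:] ^ q - [:0, 1:]))"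
    unfolding is_g_poly_def card_F by simp
  then have "(\<Sum>a\<in>F. (y + to_ac a) ^ n) = poly (map_poly to_ac (g_poly n F)) (to_ac x)"
    by (simp add: map_poly_to_ac_sum map_poly_to_ac_power map_poly_to_ac_pcompose
        map_poly_to_ac_diff map_poly_pCons poly_sum poly_pcompose assms add.commute)
  then show ?thesis by (simp add: poly_map_poly_to_ac sum.reindex inj_on_def)
qed

lemma to_ac_image: "prime_power_subfield (to_ac ` F) p m q"
  by unfold_locales
    (use prime_p q_eq is_subfield_to_ac_image[OF subfield] card_F in
      \<open>auto simp: card_image inj_on_def\<close>)

text \<open>The power sum is computed over the image of \<open>F\<close> in the algebraic closure,
  where a suitable \<open>y\<close> exists. The result lies in the image of \<open>to_ac\<close>,
  whose injectivity brings it back.\<close>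

lemma poly_g_poly_eq:
  assumes p: "odd p" and x: "(x ^ q) ^ q = x" and i: "i > 0"
    and n: "n = q ^ (p + 2 * i) - q ^ p - 1"
  shows "poly (g_poly n F) x =
    (if x \<in> F then (2 * of_nat i - 1) * inverse x
     else (2 * of_nat i - 1) * inverse x + 2 * of_nat i * inverse (x ^ q))"
proof -
  interpret ac: prime_power_subfield "to_ac ` F" p m q by (rule to_ac_image)
  \<comment> \<open>Since \<open>q ^ (2 * i)\<close> is at least 4, neither natural-number
    subtraction in \<open>n\<close> truncates and \<open>n\<close> is positive.\<close>
  have n': "n + q ^ p + 1 = q ^ (p + 2 * i)" "n > 0"
  proof -
    have "q ^ p * 3 \<le> q ^ p * q ^ (2 * i)"
    proof (rule mult_left_mono)
      have "2 ^ 2 \<le> q ^ (2 * i)" using q_gt_1 i by (intro order.trans[OF power_mono[of 2 q 2] power_increasing]) auto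
      then show "3 \<le> q ^ (2 * i)" by simp
    qed simp
    moreover have "q ^ p \<ge> 1" using q_gt_1 by simp
    ultimately have "q ^ p + 1 < q ^ (p + 2 * i)" unfolding power_add by linarith
    then show "n + q ^ p + 1 = q ^ (p + 2 * i)" "n > 0" using n by auto
  qed
  let ?T = "[:0, 1:] ^ q - [:0, 1:] + [:- to_ac x:]"
  have "degree ?T = degree ([:0, 1:] ^ q - [:0, 1:] :: 'a alg_closure poly)"
    by (intro degree_add_eq_left) (simp add: degree_artin_schreier[OF q_gt_1])
  then have "degree ?T > 0" by (simp add: degree_artin_schreier[OF q_gt_1])
  then obtain y where "poly ?T y = 0" using alg_closed_imp_poly_has_root by blast
  then have y: "y ^ q - y = to_ac x" by simp
  have mem: "to_ac x \<in> to_ac ` F \<longleftrightarrow> x \<in> F" by auto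
  have "to_ac (poly (g_poly n F) x) = (\<Sum>a\<in>to_ac ` F. (y + a) ^ n)"
    by (rule poly_g_poly_via_root[OF y])
  also have "\<dots> = (if x \<in> F then (2 * of_nat i - 1) * inverse (to_ac x)
     else (2 * of_nat i - 1) * inverse (to_ac x) + 2 * of_nat i * inverse (to_ac x ^ q))"
    unfolding mem[symmetric]
    by (rule ac.power_sum_translates[OF p _ _ n'])
      (use y in \<open>simp add: algebra_simps\<close>, simp flip: to_ac_power add: x)
  also have "\<dots> = to_ac (if x \<in> F then (2 * of_nat i - 1) * inverse x
     else (2 * of_nat i - 1) * inverse x + 2 * of_nat i * inverse (x ^ q))"
    by simp
  finally show ?thesis by (simp only: to_ac_eq_iff)
qed

end

section \<open>The quadratic extension: elements off \<open>F\<close> and the permutation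
  criterion\<close>

locale quadratic_subfield_extension = prime_power_subfield F p m q
  for F :: "'a::field set" and p m q +
  fixes K :: "'a set"
  assumes odd_p: "odd p" and subfield_K: "is_subfield K" and card_K: "card K = q ^ 2"
    and F_subset: "F \<subseteq> K"
begin

lemma finite_K: "finite K"
  using card_K q_gt_1 by (intro card_ge_0_finite) simp

lemma frobenius_twice_iff: "(x ^ q) ^ q = x \<longleftrightarrow> x \<in> K"
  using power_card_eq_iff_mem_subfield[OF subfield_K finite_K]
  by (simp add: card_K power2_eq_square power_mult)

lemma frobenius_mem: "x \<in> K \<Longrightarrow> x ^ q \<in> K"
  using frobenius_twice_iff by metis

lemma odd_q: "odd q"
  using odd_p q_eq by simp

lemma two_neq_0: "(2 :: 'a) \<noteq> 0"
proof -
  have "\<not> p dvd 2" using odd_p prime_p by (metis primes_dvd_imp_eq two_is_prime_nat dvd_refl)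
  then have "(of_nat 2 :: 'a) \<noteq> 0" unfolding of_nat_eq_0_iff_char_dvd CHAR_eq .
  then show ?thesis by simp
qed

text \<open>Put u = x - x^q. Then u^(q-1) = -1 means that u is nonzero and u^q = -u. The first says
  that \<open>x\<close> is not in \<open>F\<close>; as u^q = x^q - x^(q^2), the second says that
  x^(q^2) = x, that is, \<open>x\<close> is in \<open>K\<close>.\<close>

lemma diff_eq_roots: "K - F = {x. poly (([:0, 1:] - [:0, 1:] ^ q) ^ (q - 1) + 1) x = 0}"
proof (rule Set.set_eqI)
  fix x :: 'a
  let ?u = "x - x ^ q"
  have uq: "?u ^ q = ?u ^ (q - 1) * ?u" by (rule power_minus_mult[symmetric]) (use q_gt_1 in simp)
  have frob: "?u ^ q = x ^ q - (x ^ q) ^ q" by (rule frobenius_diff)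
  have "x \<in> K - F \<longleftrightarrow> ?u ^ (q - 1) = - 1"
  proof
    assume x: "x \<in> K - F"
    then have "?u \<noteq> 0" using power_q_eq_iff[of x] by auto
    moreover have "(x ^ q) ^ q = x" using x frobenius_twice_iff by blast
    then have "?u ^ (q - 1) * ?u = (- 1) * ?u" using uq frob by simp
    ultimately show "?u ^ (q - 1) = - 1" by (metis mult_right_cancel)
  next
    assume *: "?u ^ (q - 1) = - 1"
    then have "?u \<noteq> 0" using q_gt_1 by (intro notI) (simp add: power_0_left)
    moreover have "(x ^ q) ^ q = x" using uq frob * by simp
    ultimately show "x \<in> K - F" using power_q_eq_iff[of x] frobenius_twice_iff by auto
  qed
  then show "x \<in> K - F \<longleftrightarrow> x \<in> {x. poly (([:0, 1:] - [:0, 1:] ^ q) ^ (q - 1) + 1) x = 0}"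
    by (simp add: eq_neg_iff_add_eq_0)
qed

text \<open>After the substitution \<open>w = 1 / x\<close> the polynomial acts as \<open>w \<mapsto> c w\<close> on \<open>F\<close> and as
  \<open>L w = c w + (c + 1) w ^ q\<close> off \<open>F\<close>. Since \<open>L w ^ q - L w = - (w ^ q - w)\<close>, the map \<open>L\<close>
  preserves \<open>K - F\<close> and its kernel on \<open>K\<close> lies in \<open>F\<close>, where \<open>L\<close> is multiplication
  by \<open>2 c + 1\<close>.\<close>
lemma inj_on_piecewise_linear_iff:
  fixes c :: 'a
  assumes c: "c \<in> F" "c \<noteq> 0"
  shows "inj_on (\<lambda>w. if w \<in> F then c * w else c * w + (c + 1) * w ^ q) K \<longleftrightarrow> 2 * c + 1 \<noteq> 0"
    (is "inj_on ?h K \<longleftrightarrow> _")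
proof
  define L where "L w = c * w + (c + 1) * w ^ q" for w
  have cq: "c ^ q = c" using c(1) power_q_eq_iff by blast
  have L_frob: "L w ^ q - L w = - (w ^ q - w)" if "w \<in> K" for w
  proof -
    have "(w ^ q) ^ q = w" using that frobenius_twice_iff by blast
    then show ?thesis
      by (simp add: L_def frobenius_add power_mult_distrib cq algebra_simps)
  qed
  have L_diff: "L (v - w) = L v - L w" for v w
    by (simp add: L_def frobenius_diff algebra_simps)
  have L_mem: "L w \<in> F \<longleftrightarrow> w \<in> F" if "w \<in> K" for w
    using L_frob[OF that] by (metis eq_iff_diff_eq_0 neg_equal_0_iff_equal power_q_eq_iff)
  have hF: "?h w = c * w" if "w \<in> F" for w using that by simp
  have hL: "?h w = L w" if "w \<notin> F" for w using that by (simp add: L_def)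
  {
    assume nz: "2 * c + 1 \<noteq> 0"
    show "inj_on ?h K"
    proof (rule inj_onI)
      fix v w assume vw: "v \<in> K" "w \<in> K" and eq: "?h v = ?h w"
      \<comment> \<open>Both branches respect membership in \<open>F\<close>, so equal values must
        come from the same branch.\<close>
      have h_mem: "?h w \<in> F \<longleftrightarrow> w \<in> F" if "w \<in> K" for w
        using L_mem[OF that] hF hL is_subfieldD(4)[OF subfield c(1)] by (cases "w \<in> F") auto
      have iff: "v \<in> F \<longleftrightarrow> w \<in> F" using h_mem[OF vw(1)] h_mem[OF vw(2)] eq by metis
      show "v = w"
      proof (cases "v \<in> F")
        case True
        then show ?thesis using iff eq c(2) by simp
      next
        case False
        then have "L v = L w" using iff eq hL by metis
        then have 0: "L (v - w) = 0" by (simp add: L_diff)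
        have "v - w \<in> K" using is_subfieldD(3)[OF subfield_K] vw by blast
        then have "v - w \<in> F" using L_mem 0 is_subfieldD(1)[OF subfield] by metis
        then have "(v - w) ^ q = v - w" using power_q_eq_iff by blast
        then have "c * (v - w) + (c + 1) * (v - w) = 0" using 0 by (simp only: L_def)
        then have "(2 * c + 1) * (v - w) = 0" by (simp add: algebra_simps)
        then show ?thesis using nz by simp
      qed
    qed
  }
  assume inj: "inj_on ?h K"
  show "2 * c + 1 \<noteq> 0"
  proof
    assume 0: "2 * c + 1 = 0"
    \<comment> \<open>A collision is built outside \<open>F\<close>: both \<open>w\<close> and
      \<open>w + 1\<close> use the branch \<open>L\<close>, and their values differ by
      \<open>2 * c + 1\<close>.\<close>
    have "card F < card K"
      using q_gt_1 by (simp add: card_F card_K power2_eq_square)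
    then have "F \<noteq> K" by blast
    then obtain w where w: "w \<in> K" "w \<notin> F" using F_subset by blast
    have w1: "w + 1 \<in> K" using is_subfieldD(2,6)[OF subfield_K] w by blast
    have w1': "w + 1 \<notin> F"
      using is_subfieldD(2,3)[OF subfield] w(2) by (metis add_diff_cancel_right')
    have "L (w + 1) = L w + (2 * c + 1)"
      by (simp add: L_def frobenius_add algebra_simps)
    then have "?h (w + 1) = ?h w" using 0 hL[OF w(2)] hL[OF w1'] by simp
    then have "w + 1 = w" by (rule inj_onD[OF inj _ w1 w(1)])
    then show False by simp
  qed
qed

text \<open>With \<open>c = 2 * i - 1\<close>, \<open>g_poly\<close> acts on \<open>K\<close> as the
  piecewise linear map after inversion, which permutes \<open>K\<close> because
  \<open>inverse 0 = 0\<close>. As \<open>K\<close> is finite and mapped into itself, injectivity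
  decides, and 2c + 1 = 4i - 1.\<close>

lemma permutation_poly_g_poly_iff:
  assumes i: "0 < i" "i \<le> (p - 1) div 2" and n: "n = q ^ (p + 2 * i) - q ^ p - 1"
  shows "permutation_poly_on K (g_poly n F) \<longleftrightarrow> \<not> [4 * i = 1] (mod p)"
proof -
  define c :: 'a where "c = of_nat (2 * i - 1)"
  have c_eq: "c = 2 * of_nat i - 1" using i(1) by (simp add: c_def of_nat_diff)
  have c: "c \<in> F" "c \<noteq> 0"
  proof -
    show "c \<in> F" unfolding c_def by (rule subfield_of_nat_mem[OF subfield])
    \<comment> \<open>The bounds on \<open>i\<close> give 0 < 2i - 1 < p.\<close>
    have "\<not> p dvd 2 * i - 1" using i by (intro nat_dvd_not_less) linarith+
    then show "c \<noteq> 0" unfolding c_def of_nat_eq_0_iff_char_dvd CHAR_eq .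
  qed
  let ?h = "\<lambda>w. if w \<in> F then c * w else c * w + (c + 1) * w ^ q"
  have inv_mem: "inverse x \<in> E \<longleftrightarrow> x \<in> E" if "is_subfield E" for x :: 'a and E
    using is_subfieldD(5)[OF that] by (metis inverse_inverse_eq)
  have g: "poly (g_poly n F) x = ?h (inverse x)" if "x \<in> K" for x
  proof -
    have "(x ^ q) ^ q = x" using that frobenius_twice_iff by blast
    from poly_g_poly_eq[OF odd_p this i(1) n] show ?thesis
      by (simp add: inv_mem[OF subfield] c_eq power_inverse)
  qed
  have h_K: "?h w \<in> K" if "w \<in> K" for w
    using that c(1) F_subset frobenius_mem[OF that] is_subfieldD(2,4,6)[OF subfield_K] by auto
  have inv: "bij_betw inverse K K"
    by (rule bij_betwI[where g = inverse]) (use is_subfieldD(5)[OF subfield_K] in auto)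
  have "permutation_poly_on K (g_poly n F) \<longleftrightarrow> bij_betw (?h \<circ> inverse) K K"
    unfolding permutation_poly_on_def using g by (intro bij_betw_cong) simp
  also have "\<dots> \<longleftrightarrow> bij_betw ?h K K"
    by (rule bij_betw_comp_iff[OF inv, symmetric])
  also have "\<dots> \<longleftrightarrow> inj_on ?h K"
    using h_K endo_inj_surj[OF finite_K, of ?h] unfolding bij_betw_def by blast
  also have "\<dots> \<longleftrightarrow> 2 * c + 1 \<noteq> 0" by (rule inj_on_piecewise_linear_iff[OF c])
  also have "2 * c + 1 = of_nat (4 * i) - of_nat 1" by (simp add: c_eq)
  also have "\<dots> \<noteq> 0 \<longleftrightarrow> \<not> [4 * i = 1] (mod p)"
    unfolding right_minus_eq of_nat_eq_iff_cong_CHAR CHAR_eq ..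
  finally show ?thesis .
qed

end

theorem theorem5p6:
  fixes p q m :: nat and F K :: "'a::field set"
  assumes "prime p" and "odd p" and "m \<ge> 1" and "q = p ^ m"
    and "is_subfield F" and "card F = q"
    and "is_subfield K" and "card K = q ^ 2" and "F \<subseteq> K"
  shows
    "K - F = {x. poly (([:0, 1:] - [:0, 1:] ^ q) ^ (q - 1) + 1) x = 0} \<and>
     (\<forall>i n :: nat. 0 < i \<and> i \<le> (p - 1) div 2 \<and> n = q ^ (p + 2 * i) - q ^ p - 1 \<longrightarrow>
        (\<forall>x\<in>F. poly (g_poly n F) x = (2 * of_nat i - 1) * x ^ (q - 2)) \<and>
        (\<forall>x\<in>K - F. poly (g_poly n F) x = (2 * of_nat i - 1) / x + (2 * of_nat i) / x ^ q) \<and>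
        (permutation_poly_on K (g_poly n F) \<longleftrightarrow> \<not> [4 * i = 1] (mod p)))"
proof -
  interpret quadratic_subfield_extension F p m q K
    by unfold_locales (use assms in auto)
  have on_F: "poly (g_poly n F) x = (2 * of_nat i - 1) * x ^ (q - 2)"
    if "0 < i" "n = q ^ (p + 2 * i) - q ^ p - 1" "x \<in> F" for i n :: nat and x
  proof -
    have xq: "x ^ q = x" using that(3) power_q_eq_iff by blast
    have q3: "q > 2" using odd_q q_gt_1 by (cases "q = 2") auto
    \<comment> \<open>This includes \<open>x = 0\<close>: the exponent \<open>q - 2\<close> is
      positive, so both sides are 0.\<close>
    have "x ^ (q - 2) = inverse x"
    proof (cases "x = 0")
      case False
      have q2: "q - 2 + 2 = q" using q3 by simp
      have "x ^ (q - 2) * x * x = x ^ (q - 2 + 2)"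
        by (simp only: power_add power2_eq_square mult.assoc)
      also have "\<dots> = x" by (simp only: q2 xq)
      finally have "x ^ (q - 2) * x = 1" using False by (simp only: mult_cancel_right2 simp_thms)
      then show ?thesis using False by (simp add: field_simps)
    qed (use q3 in simp)
    then show ?thesis using poly_g_poly_eq[OF odd_p _ that(1,2), of x] that(3) xq by simp
  qed
  have off_F: "poly (g_poly n F) x = (2 * of_nat i - 1) / x + (2 * of_nat i) / x ^ q"
    if "0 < i" "n = q ^ (p + 2 * i) - q ^ p - 1" "x \<in> K - F" for i n :: nat and x
    using poly_g_poly_eq[OF odd_p _ that(1,2), of x] that(3) frobenius_twice_iff
    by (simp add: divide_inverse)
  show ?thesis
    using diff_eq_roots on_F off_F permutation_poly_g_poly_iff by blast
qed

end
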